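(* Let $W\subset\mathbb{R}^n$ be a linear subspace and $V=W^\perp$. Then $W$ is feasible curvature-free if and only if, for every $z\in\widehat X$, $$\text{(i)}\quad H_{WW}(z)\preceq0,\qquad\qquad \text{(ii)}\quad \operatorname{range}H_{WV}(z)\subset\operatorname{range}(-H_{WW}(z)),$$ and $$\text{(iii)}\quad \sup_{z\in\widehat X}\lambda_{\max}(R_W(z))<+\infty .$$ When these conditions hold, $B=\alpha P_V$ belongs to $\mathcal{B}(f;X)$ for every $$\alpha\ge\max\Bigl\{0,\ \sup_{z\in\widehat X}\lambda_{\max}(R_W(z))\Bigr\}.$$ More generally, for a symmetric positive semidefinite operator $B_V$ on $V$, the block matrix $\operatorname{diag}(B_V,0)$ (relative to $\mathbb{R}^n=V\oplus W$) belongs to $\mathcal{B}(f;X)$ if and only if (i) and (ii) hold for every $z\in\widehat X$ and $B_V\succeq R_W(z)$ for every $z\in\widehat X$.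
   Context: $X\subset\mathbb{R}^n$ is compact and full dimensional (its affine hull is $\mathbb{R}^n$), $\widehat X=\operatorname{conv}X$, and $f$ is a real-valued $C^2$ function on an open neighborhood of $\widehat X$. $\succeq,\preceq$ denote the Loewner order, $P_V$ is Euclidean orthogonal projection onto $V$, and $\lambda_{\max}$ is the largest eigenvalue. $\mathcal{B}(f;X)=\{B\in\mathbb{R}^{n\times n}\text{ symmetric positive semidefinite}: B-\nabla^2f(z)\succeq0\text{ for every }z\in\widehat X\}$. A subspace $W$ is called a feasible curvature-free subspace if some $B\in\mathcal{B}(f;X)$ satisfies $W\subset\ker B$. Relative to the orthogonal decomposition $\mathbb{R}^n=V\oplus W$ write $$\nabla^2f(z)=\begin{pmatrix}H_{VV}(z)&H_{VW}(z)\\H_{WV}(z)&H_{WW}(z)\end{pmatrix},$$ so that, e.g., $H_{WV}(z):V\to W$. Whenever $-H_{WW}(z)\succeq0$, define $$R_W(z)=H_{VV}(z)+H_{VW}(z)\,(-H_{WW}(z))^\dagger\,H_{WV}(z),$$ where $A^\dagger$ is the Moore–Penrose pseudoinverse. If $V=\{0\}$, all conditions involving $R_W$ are vacuous. *)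

theory Defs
  imports "HOL-Analysis.Analysis"
begin

subsection \<open>Twice continuously differentiable functions and the Hessian\<close>

definition partial_deriv :: "'n \<Rightarrow> (real^'n \<Rightarrow> real) \<Rightarrow> real^'n \<Rightarrow> real" where
  "partial_deriv i f x = frechet_derivative f (at x) (axis i 1)"

text \<open>These two notions are meant for open sets \<open>U\<close> only.\<close>

definition C1_on :: "(real^'n) set \<Rightarrow> (real^'n \<Rightarrow> real) \<Rightarrow> bool" where
  "C1_on U f \<longleftrightarrow> f differentiable_on U \<and> (\<forall>i. continuous_on U (partial_deriv i f))"

definition C2_on :: "(real^'n) set \<Rightarrow> (real^'n \<Rightarrow> real) \<Rightarrow> bool" where
  "C2_on U f \<longleftrightarrow> f differentiable_on U \<and> (\<forall>i. C1_on U (partial_deriv i f))"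

definition hessian :: "(real^'n \<Rightarrow> real) \<Rightarrow> real^'n \<Rightarrow> real^'n^'n" where
  "hessian f z = (\<chi> i j. partial_deriv i (partial_deriv j f) z)"

subsection \<open>Operators on subspaces\<close>

text \<open>
  A linear map \<open>S \<rightarrow> T\<close> between subspaces of the ambient space is represented by
  any linear function on the ambient space that maps \<open>S\<close> into \<open>T\<close>; only its
  values on \<open>S\<close> matter.
\<close>

definition orth_proj :: "(real^'n) set \<Rightarrow> real^'n \<Rightarrow> real^'n" where
  "orth_proj V x = (THE p. p \<in> V \<and> x - p \<in> orthogonal_comp V)"

text \<open>The block \<open>M\<^bsub>ST\<^esub> : T \<rightarrow> S\<close> of the matrix \<open>M\<close>.\<close>

definition block :: "(real^'n) set \<Rightarrow> (real^'n) set \<Rightarrow> real^'n^'n \<Rightarrow> real^'n \<Rightarrow> real^'n" where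
  "block S T M x = orth_proj S (M *v orth_proj T x)"

definition psd_on :: "(real^'n) set \<Rightarrow> (real^'n \<Rightarrow> real^'n) \<Rightarrow> bool" where
  "psd_on V A \<longleftrightarrow> linear A \<and> A ` V \<subseteq> V \<and>
     (\<forall>x\<in>V. \<forall>y\<in>V. A x \<bullet> y = x \<bullet> A y) \<and> (\<forall>x\<in>V. 0 \<le> x \<bullet> A x)"

definition loewner_le_on ::
    "(real^'n) set \<Rightarrow> (real^'n \<Rightarrow> real^'n) \<Rightarrow> (real^'n \<Rightarrow> real^'n) \<Rightarrow> bool" where
  "loewner_le_on V A B \<longleftrightarrow> psd_on V (\<lambda>x. B x - A x)"

text \<open>
  The largest eigenvalue of \<open>A : V \<rightarrow> V\<close>, with eigenvectors in \<open>V\<close>; a junk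
  value if \<open>V = {0}\<close>.
\<close>

definition lambda_max :: "(real^'n) set \<Rightarrow> (real^'n \<Rightarrow> real^'n) \<Rightarrow> real" where
  "lambda_max V A = Max {l. \<exists>v\<in>V. v \<noteq> 0 \<and> A v = l *\<^sub>R v}"

text \<open>
  The four Penrose equations for \<open>A : S \<rightarrow> T\<close> and \<open>G : T \<rightarrow> S\<close>. They determine \<open>G\<close>
  on \<open>T\<close>, so that the choice in \<open>pinv\<close> only affects values outside \<open>T\<close>.
\<close>

definition is_pinv ::
    "(real^'n) set \<Rightarrow> (real^'n) set \<Rightarrow> (real^'n \<Rightarrow> real^'n) \<Rightarrow> (real^'n \<Rightarrow> real^'n) \<Rightarrow> bool" where
  "is_pinv S T A G \<longleftrightarrow> linear G \<and> G ` T \<subseteq> S \<and>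
     (\<forall>x\<in>S. A (G (A x)) = A x) \<and>
     (\<forall>y\<in>T. G (A (G y)) = G y) \<and>
     (\<forall>y\<in>T. \<forall>y'\<in>T. A (G y) \<bullet> y' = y \<bullet> A (G y')) \<and>
     (\<forall>x\<in>S. \<forall>x'\<in>S. G (A x) \<bullet> x' = x \<bullet> G (A x'))"

definition pinv ::
    "(real^'n) set \<Rightarrow> (real^'n) set \<Rightarrow> (real^'n \<Rightarrow> real^'n) \<Rightarrow> real^'n \<Rightarrow> real^'n" where
  "pinv S T A = (SOME G. is_pinv S T A G)"

subsection \<open>Curvature bounds\<close>

text \<open>\<open>psd_on UNIV\<close> includes the symmetry of the matrix.\<close>

definition curvature_bounds :: "(real^'n \<Rightarrow> real) \<Rightarrow> (real^'n) set \<Rightarrow> (real^'n^'n) set" where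
  "curvature_bounds f X = {B. psd_on UNIV ((*v) B) \<and>
     (\<forall>z\<in>convex hull X. psd_on UNIV ((*v) (B - hessian f z)))}"

definition feasible_curvature_free ::
    "(real^'n \<Rightarrow> real) \<Rightarrow> (real^'n) set \<Rightarrow> (real^'n) set \<Rightarrow> bool" where
  "feasible_curvature_free f X W \<longleftrightarrow>
     subspace W \<and> (\<exists>B\<in>curvature_bounds f X. W \<subseteq> {x. B *v x = 0})"

text \<open>\<open>R\<^sub>W(z) : V \<rightarrow> V\<close> for \<open>V = W\<^sup>\<bottom>\<close>; meaningful if \<open>-H\<^bsub>WW\<^esub>(z)\<close> is positive semidefinite.\<close>

definition R_op :: "(real^'n \<Rightarrow> real) \<Rightarrow> (real^'n) set \<Rightarrow> real^'n \<Rightarrow> real^'n \<Rightarrow> real^'n" where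
  "R_op f W z x =
     (let V = orthogonal_comp W; H = hessian f z in
        block V V H x + block V W H (pinv W W (\<lambda>w. - block W W H w) (block W V H x)))"

end

(*
  Fix z, write H for the Hessian at z and A = -H_WW. If A is positive semidefinite and
  H_WV x = A u for x in V, completing the square gives, for every w in W,
    <(diag(B_V, 0) - H) (x + w), x + w> = <(B_V - R_W) x, x> + <A (w - u), w - u>,
  so diag(B_V, 0) - H is positive semidefinite iff A >= 0 and B_V >= R_W on V, provided
  range H_WV is contained in range A. The range condition is itself forced: a vector k in W
  with A k = 0 is a null vector of the semidefinite form diag(B_V, 0) - H, hence H k = 0, so
  H_WV x is orthogonal to ker A and lies in range A. The eigenvalue bound enters because
  alpha I >= R_W on V iff lambda_max R_W <= alpha. Conversely, any B that is admissible and
  vanishes on W is diag(B, 0), and the norm of B bounds all the R_W(z).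
*)
theory Submission
  imports Defs
begin

subsection \<open>Symmetry of the Hessian\<close>

lemma DERIV_along_axis:
  assumes "g differentiable (at (p + t *\<^sub>R axis i 1))"
  shows "((\<lambda>s. g (p + s *\<^sub>R axis i 1)) has_real_derivative
    partial_deriv i g (p + t *\<^sub>R axis i 1)) (at t)"
proof -
  let ?q = "p + t *\<^sub>R axis i 1"
  let ?D = "frechet_derivative g (at ?q)"
  have D: "(g has_derivative ?D) (at ?q)"
    using assms by (simp add: frechet_derivative_works)
  have "((\<lambda>s. p + s *\<^sub>R axis i (1::real)) has_derivative (\<lambda>s. s *\<^sub>R axis i 1)) (at t)"
    by (auto intro!: derivative_eq_intros)
  from has_derivative_compose[OF this D]
  have "((\<lambda>s. g (p + s *\<^sub>R axis i 1)) has_derivative (\<lambda>s. ?D (s *\<^sub>R axis i 1))) (at t)" .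
  moreover have "(\<lambda>s. ?D (s *\<^sub>R axis i 1)) = (*) (partial_deriv i g ?q)"
    by (simp add: fun_eq_iff partial_deriv_def linear_scale[OF has_derivative_linear[OF D]])
  ultimately show ?thesis by (simp add: has_field_derivative_def)
qed

lemma dist_axis_add:
  fixes z :: "real^'n"
  assumes "\<bar>s\<bar> \<le> h" "\<bar>t\<bar> \<le> h"
  shows "dist z (z + s *\<^sub>R axis i 1 + t *\<^sub>R axis j 1) \<le> 2 * h"
proof -
  have "norm (s *\<^sub>R axis i (1::real) + t *\<^sub>R axis j 1) \<le> \<bar>s\<bar> + \<bar>t\<bar>"
    using norm_triangle_ineq[of "s *\<^sub>R axis i (1::real)" "t *\<^sub>R axis j 1"] by (simp add: norm_axis_1)
  then show ?thesis
    using assms norm_minus_commute[of z "z + s *\<^sub>R axis i 1 + t *\<^sub>R axis j 1"]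
    by (simp add: dist_norm algebra_simps)
qed

text \<open>The second difference over the rectangle with sides \<open>h\<close> is handled by two
  applications of the mean value theorem: first to a difference of \<open>f\<close> in direction
  \<open>i\<close>, then to \<open>partial_deriv i f\<close> in direction \<open>j\<close>. All
  points involved stay within distance \<open>2 * h\<close> of \<open>z\<close>.\<close>

lemma second_difference_mean_value:
  assumes f: "\<And>x. x \<in> cball z (2 * h) \<Longrightarrow> f differentiable (at x)"
    and fi: "\<And>x. x \<in> cball z (2 * h) \<Longrightarrow> partial_deriv i f differentiable (at x)"
    and h: "h > 0"
  obtains x where "dist z x \<le> 2 * h"
    "f (z + h *\<^sub>R axis i 1 + h *\<^sub>R axis j 1) - f (z + h *\<^sub>R axis i 1)
      - f (z + h *\<^sub>R axis j 1) + f z = h * h * partial_deriv j (partial_deriv i f) x"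
proof -
  let ?i = "axis i (1::real)" and ?j = "axis j (1::real)"
  have dist: "z + s *\<^sub>R ?i + t *\<^sub>R ?j \<in> cball z (2 * h)" if "0 \<le> s" "s \<le> h" "0 \<le> t" "t \<le> h" for s t
    using dist_axis_add[of s h t z i j] that by simp
  \<comment> \<open>The increment of \<open>?\<phi>\<close> from \<open>0\<close> to
    \<open>h\<close> is exactly the second difference.\<close>
  let ?\<phi> = "\<lambda>s. f (z + h *\<^sub>R ?j + s *\<^sub>R ?i) - f (z + s *\<^sub>R ?i)"
  have "\<exists>s. s > 0 \<and> s < h \<and> ?\<phi> h - ?\<phi> 0 = (h - 0) *
    (partial_deriv i f (z + h *\<^sub>R ?j + s *\<^sub>R ?i) - partial_deriv i f (z + s *\<^sub>R ?i))"
  proof (rule MVT2[OF h])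
    fix s :: real assume s: "0 \<le> s" "s \<le> h"
    show "(?\<phi> has_real_derivative
      partial_deriv i f (z + h *\<^sub>R ?j + s *\<^sub>R ?i) - partial_deriv i f (z + s *\<^sub>R ?i)) (at s)"
      by (intro DERIV_diff DERIV_along_axis f)
        (use dist[OF s, of h] dist[OF s, of 0] h in \<open>auto simp: algebra_simps\<close>)
  qed
  then obtain s where s: "0 \<le> s" "s \<le> h" and 1: "?\<phi> h - ?\<phi> 0 =
    h * (partial_deriv i f (z + h *\<^sub>R ?j + s *\<^sub>R ?i) - partial_deriv i f (z + s *\<^sub>R ?i))"
    using less_imp_le by (metis diff_zero)
  let ?\<psi> = "\<lambda>t. partial_deriv i f (z + s *\<^sub>R ?i + t *\<^sub>R ?j)"
  have "\<exists>t. t > 0 \<and> t < h \<and> ?\<psi> h - ?\<psi> 0 = (h - 0) *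
    partial_deriv j (partial_deriv i f) (z + s *\<^sub>R ?i + t *\<^sub>R ?j)"
    by (rule MVT2[OF h], intro DERIV_along_axis fi dist s)
  then obtain t where t: "0 \<le> t" "t \<le> h" and 2: "?\<psi> h - ?\<psi> 0 =
    h * partial_deriv j (partial_deriv i f) (z + s *\<^sub>R ?i + t *\<^sub>R ?j)"
    using less_imp_le by (metis diff_zero)
  show ?thesis
  proof (rule that)
    show "dist z (z + s *\<^sub>R ?i + t *\<^sub>R ?j) \<le> 2 * h" using dist[OF s t] by simp
  qed (use 1 2 in \<open>simp add: algebra_simps\<close>)
qed

text \<open>Schwarz's theorem: the second difference is symmetric in \<open>i\<close> and
  \<open>j\<close>, so the two mixed derivatives agree at two suitable points arbitrarily close to
  \<open>z\<close>, and continuity carries the equality over to \<open>z\<close>.\<close>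

lemma partial_deriv_commute:
  assumes U: "open U" "z \<in> U" and f: "C2_on U f"
  shows "partial_deriv i (partial_deriv j f) z = partial_deriv j (partial_deriv i f) z"
proof -
  let ?D = "\<lambda>i j. partial_deriv i (partial_deriv j f)"
  have C: "f differentiable_on U" "\<And>k. partial_deriv k f differentiable_on U"
    "\<And>i j. continuous_on U (?D i j)"
    using f unfolding C2_on_def C1_on_def by blast+
  have d: "f differentiable (at x)" "partial_deriv k f differentiable (at x)" if "x \<in> U" for x k
    using C(1,2) that unfolding differentiable_on_def at_within_open[OF that U(1)]
    by (metis at_within_open[OF that U(1)])+
  have cont: "isCont (?D i j) z" for i j
    using C(3) U by (simp add: continuous_on_eq_continuous_at)
  have "dist (?D i j z) (?D j i z) \<le> e" if "e > 0" for e
  proof -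
    obtain a b where a: "a > 0" "\<And>x. dist x z < a \<Longrightarrow> dist (?D i j x) (?D i j z) < e / 2"
      and b: "b > 0" "\<And>x. dist x z < b \<Longrightarrow> dist (?D j i x) (?D j i z) < e / 2"
      using cont[of i j] cont[of j i] half_gt_zero[OF \<open>e > 0\<close>]
      unfolding continuous_at_eps_delta by blast
    obtain r where r: "r > 0" "cball z r \<subseteq> U" using U open_contains_cball by blast
    \<comment> \<open>Dividing by 4 makes \<open>2 * h\<close> strictly smaller than
      \<open>a\<close> and \<open>b\<close>, so both continuity estimates apply on
      \<open>cball z (2 * h)\<close>, which also lies in \<open>U\<close>.\<close>
    define h where "h = min r (min a b) / 4"
    have h: "h > 0" "2 * h < a" "2 * h < b" "2 * h \<le> r" using a b r by (auto simp: h_def)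
    then have "cball z (2 * h) \<subseteq> U" using r(2) by auto
    then have diff: "f differentiable (at x)" "partial_deriv k f differentiable (at x)"
      if "x \<in> cball z (2 * h)" for x k using d that by blast+
    obtain x where x: "dist z x \<le> 2 * h"
      "f (z + h *\<^sub>R axis i 1 + h *\<^sub>R axis j 1) - f (z + h *\<^sub>R axis i 1)
        - f (z + h *\<^sub>R axis j 1) + f z = h * h * ?D j i x"
      using second_difference_mean_value[OF diff h(1)] by blast
    \<comment> \<open>The same second difference, with the roles of \<open>i\<close> and
      \<open>j\<close> exchanged.\<close>
    obtain y where y: "dist z y \<le> 2 * h"
      "f (z + h *\<^sub>R axis j 1 + h *\<^sub>R axis i 1) - f (z + h *\<^sub>R axis j 1)
        - f (z + h *\<^sub>R axis i 1) + f z = h * h * ?D i j y"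
      using second_difference_mean_value[OF diff h(1)] by blast
    have "h * h * ?D j i x = h * h * ?D i j y"
      using x(2) y(2) by (simp add: algebra_simps)
    then have "?D j i x = ?D i j y" using h(1) by simp
    moreover have "dist (?D i j y) (?D i j z) < e / 2"
      using a(2)[of y] y(1) h(2) by (simp add: dist_commute)
    moreover have "dist (?D j i x) (?D j i z) < e / 2"
      using b(2)[of x] x(1) h(3) by (simp add: dist_commute)
    ultimately show ?thesis
      using dist_triangle_half_r[of "?D i j y" "?D i j z" e "?D j i z"] by simp
  qed
  then have "dist (?D i j z) (?D j i z) \<le> 0" by (rule field_le_epsilon) simp
  then show ?thesis by simp
qed

lemma hessian_selfadjoint:
  assumes "open U" "z \<in> U" "C2_on U f"
  shows "(hessian f z *v x) \<bullet> y = x \<bullet> (hessian f z *v y)"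
proof -
  have "transpose (hessian f z) = hessian f z"
    using partial_deriv_commute[OF assms] by (simp add: transpose_def hessian_def vec_eq_iff)
  then show ?thesis by (metis dot_lmul_matrix inner_commute transpose_matrix_vector)
qed

subsection \<open>Orthogonal projections and blocks\<close>

text \<open>Uniqueness for the description in \<open>orth_proj\<close>: the difference of two
  candidates lies in \<open>V\<close> and is orthogonal to both residuals, hence to itself.\<close>

lemma orth_proj_eqI:
  assumes "subspace V" "p \<in> V" "\<And>y. y \<in> V \<Longrightarrow> (x - p) \<bullet> y = 0"
  shows "orth_proj V x = p"
  unfolding orth_proj_def
proof (rule the_equality)
  show "p \<in> V \<and> x - p \<in> orthogonal_comp V"
    using assms by (auto simp: orthogonal_comp_def orthogonal_def inner_commute)
next
  fix q assume q: "q \<in> V \<and> x - q \<in> orthogonal_comp V"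
  have "p - q \<in> V" using q assms by (simp add: subspace_diff)
  then have "(p - q) \<bullet> (x - q) = 0" "(x - p) \<bullet> (p - q) = 0"
    using q assms by (auto simp: orthogonal_comp_def orthogonal_def)
  then have "(p - q) \<bullet> (p - q) = 0"
    by (simp add: inner_diff_left inner_diff_right inner_commute)
  then show "q = p" by simp
qed

lemma orth_proj_decomp:
  assumes "subspace V"
  shows orth_proj_in: "orth_proj V x \<in> V"
    and inner_diff_orth_proj: "y \<in> V \<Longrightarrow> (x - orth_proj V x) \<bullet> y = 0"
proof -
  have sp: "span V = V" using assms by (simp add: span_eq_iff)
  obtain p q where p: "p \<in> V" "\<And>y. y \<in> V \<Longrightarrow> orthogonal q y" "x = p + q"
    using orthogonal_subspace_decomp_exists[of V x] unfolding sp by blast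
  then have "orth_proj V x = p"
    by (intro orth_proj_eqI assms) (auto simp: orthogonal_def)
  then show "orth_proj V x \<in> V" "y \<in> V \<Longrightarrow> (x - orth_proj V x) \<bullet> y = 0"
    using p by (auto simp: orthogonal_def)
qed

lemma inner_orth_proj:
  assumes "subspace V" "y \<in> V"
  shows "orth_proj V x \<bullet> y = x \<bullet> y" and "y \<bullet> orth_proj V x = y \<bullet> x"
  using inner_diff_orth_proj[OF assms, of x] by (auto simp: inner_diff_left inner_diff_right inner_commute[of y])

lemma orth_proj_ident [simp]: "subspace V \<Longrightarrow> x \<in> V \<Longrightarrow> orth_proj V x = x"
  by (intro orth_proj_eqI) auto

lemma linear_orth_proj:
  assumes "subspace V" shows "linear (orth_proj V)"
proof (rule linearI)
  show "orth_proj V (x + y) = orth_proj V x + orth_proj V y" for x y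
    by (rule orth_proj_eqI)
      (use assms in \<open>auto simp: subspace_add orth_proj_in inner_diff_left inner_add_left inner_orth_proj\<close>)
  show "orth_proj V (c *\<^sub>R x) = c *\<^sub>R orth_proj V x" for c x
    by (rule orth_proj_eqI)
      (use assms in \<open>auto simp: subspace_scale orth_proj_in inner_diff_left inner_orth_proj\<close>)
qed

lemma orth_proj_selfadjoint:
  assumes "subspace V"
  shows "orth_proj V x \<bullet> y = x \<bullet> orth_proj V y"
  using inner_orth_proj[OF assms orth_proj_in[OF assms]] by metis

lemma inner_orthogonal_comp:
  "x \<in> orthogonal_comp W \<Longrightarrow> w \<in> W \<Longrightarrow> x \<bullet> w = 0"
  "x \<in> orthogonal_comp W \<Longrightarrow> w \<in> W \<Longrightarrow> w \<bullet> x = 0"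
  by (auto simp: orthogonal_comp_def orthogonal_def inner_commute)

lemma orth_proj_orthogonal_comp:
  assumes "subspace W"
  shows "orth_proj (orthogonal_comp W) x = x - orth_proj W x"
proof (rule orth_proj_eqI)
  show "x - orth_proj W x \<in> orthogonal_comp W"
    using inner_diff_orth_proj[OF assms]
    unfolding orthogonal_comp_def orthogonal_def by (simp add: inner_commute)
  show "(x - (x - orth_proj W x)) \<bullet> y = 0" if "y \<in> orthogonal_comp W" for y
    using inner_orthogonal_comp(2)[OF that orth_proj_in[OF assms]] by simp
qed (rule subspace_orthogonal_comp)

lemma linear_block:
  assumes "subspace S" "subspace T"
  shows "linear (block S T M)"
proof -
  have "block S T M = orth_proj S \<circ> (*v) M \<circ> orth_proj T"
    by (auto simp: block_def)
  then show ?thesis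
    by (simp add: assms linear_compose linear_orth_proj)
qed

lemma inner_block:
  assumes "subspace S" "subspace T" "x \<in> T" "y \<in> S"
  shows "block S T M x \<bullet> y = (M *v x) \<bullet> y"
  using assms by (simp add: block_def inner_orth_proj)

lemma block_in: "subspace S \<Longrightarrow> block S T M x \<in> S"
  by (simp add: block_def orth_proj_in)

lemma inner_block_swap:
  assumes "subspace S" "subspace T" "\<And>x y. (M *v x) \<bullet> y = x \<bullet> (M *v y)"
  shows "block S T M x \<bullet> y = x \<bullet> block T S M y"
  using assms by (simp add: block_def orth_proj_selfadjoint)

subsection \<open>Self-adjoint operators on a subspace\<close>

text \<open>If \<open>A v\<close> were nonzero, a small move from the null vector \<open>v\<close>
  in direction \<open>- A v\<close> would make the form negative: its linear term in the step size
  dominates the quadratic one.\<close>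

lemma psd_on_null:
  assumes "subspace V" "psd_on V A" "v \<in> V" "v \<bullet> A v = 0"
  shows "A v = 0"
proof (rule ccontr)
  assume ne: "A v \<noteq> 0"
  define y where "y = A v"
  define n where "n = y \<bullet> y"
  define c where "c = y \<bullet> A y"
  \<comment> \<open>The form at \<open>v - t *\<^sub>R y\<close> equals
    \<open>t * (t * c - 2 * n)\<close>. This choice gives \<open>t * c = n - t < 2 * n\<close>, and
    the summand 1 keeps the denominator positive when \<open>c = 0\<close>.\<close>
  define t where "t = n / (c + 1)"
  have lin: "linear A" and y: "y \<in> V"
    and sym: "\<And>x y. x \<in> V \<Longrightarrow> y \<in> V \<Longrightarrow> A x \<bullet> y = x \<bullet> A y"
    and pos: "\<And>x. x \<in> V \<Longrightarrow> 0 \<le> x \<bullet> A x"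
    using assms by (auto simp: psd_on_def y_def)
  have n: "n > 0" using ne by (simp add: n_def y_def)
  have c: "c \<ge> 0" using pos[OF y] by (simp add: c_def)
  have tc: "t * (c + 1) = n" "t > 0" using n c by (auto simp: t_def)
  have "v \<bullet> A y = n"
    using sym[OF assms(3) y] by (simp add: n_def y_def)
  then have "(v - t *\<^sub>R y) \<bullet> A (v - t *\<^sub>R y) = - 2 * t * n + t * t * c"
    using assms(4)
    by (simp add: linear_diff[OF lin] linear_scale[OF lin] inner_diff_left inner_diff_right
        inner_commute c_def[symmetric] y_def[symmetric] n_def[symmetric] algebra_simps)
  moreover have "v - t *\<^sub>R y \<in> V"
    using assms y by (simp add: subspace_diff subspace_scale)
  ultimately have "0 \<le> t * (t * c - 2 * n)"
    using pos[of "v - t *\<^sub>R y"] by (simp add: algebra_simps)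
  then have "0 \<le> t * c - 2 * n" using tc(2) by (simp add: zero_le_mult_iff)
  moreover have "t * c = n - t" using tc(1) by (simp add: algebra_simps)
  ultimately show False using n tc(2) by simp
qed

lemma selfadjoint_range_if_orthogonal_kernel:
  fixes A :: "real^'n \<Rightarrow> real^'n"
  assumes "subspace W" "linear A" "A ` W \<subseteq> W"
    and sym: "\<And>x y. x \<in> W \<Longrightarrow> y \<in> W \<Longrightarrow> A x \<bullet> y = x \<bullet> A y"
    and "y \<in> W" "\<And>k. k \<in> W \<Longrightarrow> A k = 0 \<Longrightarrow> y \<bullet> k = 0"
  shows "y \<in> A ` W"
proof -
  have R: "subspace (A ` W)" using assms by (simp add: linear_subspace_image)
  define p where "p = orth_proj (A ` W) y"
  have p: "p \<in> A ` W" "\<And>w. w \<in> W \<Longrightarrow> (y - p) \<bullet> A w = 0"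
    using R by (auto simp: p_def orth_proj_in inner_diff_orth_proj)
  have q: "y - p \<in> W" using p assms by (auto intro: subspace_diff)
  have "A (y - p) \<bullet> A (y - p) = (y - p) \<bullet> A (A (y - p))"
    using sym[OF q, of "A (y - p)"] q assms by blast
  also have "\<dots> = 0" using p q assms by blast
  finally have "A (y - p) = 0" by simp
  then have "y \<bullet> (y - p) = 0" using assms q by blast
  moreover have "p \<bullet> (y - p) = 0" using p by (auto simp: inner_commute)
  ultimately have "(y - p) \<bullet> (y - p) = 0" by (simp add: inner_diff_left)
  then show ?thesis using p by simp
qed

section \<open>The pseudoinverse of a self-adjoint operator\<close>

text \<open>A self-adjoint operator is injective on its own range. The pseudoinverse projects onto
  the range and then applies a left inverse \<open>g\<close> of this restriction.\<close>

lemma is_pinv_exists: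
  assumes W: "subspace W" and lin: "linear A" and AW: "A ` W \<subseteq> W"
    and sym: "\<And>x y. x \<in> W \<Longrightarrow> y \<in> W \<Longrightarrow> A x \<bullet> y = x \<bullet> A y"
  shows "\<exists>G. is_pinv W W (A :: real^'n \<Rightarrow> real^'n) G"
proof -
  let ?R = "A ` W"
  have R: "subspace ?R" using W lin by (simp add: linear_subspace_image)
  define P where "P = orth_proj ?R"
  have P: "P x \<in> ?R" "P x \<in> W" for x using orth_proj_in[OF R] AW by (auto simp: P_def)
  have Psym: "P x \<bullet> y = x \<bullet> P y" for x y
    using orth_proj_selfadjoint[OF R] by (simp add: P_def)
  have Pid: "x \<in> ?R \<Longrightarrow> P x = x" for x using R by (simp add: P_def)
  \<comment> \<open>\<open>x - P x\<close> is orthogonal to the range, so symmetry puts it in the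
    kernel of \<open>A\<close>.\<close>
  have AP: "A (P x) = A x" if "x \<in> W" for x
  proof -
    have d: "x - P x \<in> W" using that P W by (simp add: subspace_diff)
    have "A (x - P x) \<bullet> A (x - P x) = (x - P x) \<bullet> A (A (x - P x))"
      using sym[OF d, of "A (x - P x)"] d AW by blast
    also have "\<dots> = 0"
      unfolding P_def by (rule inner_diff_orth_proj[OF R]) (use d AW P_def in blast)
    finally show ?thesis by (simp add: linear_diff[OF lin])
  qed
  have "inj_on A ?R"
  proof (subst linear_inj_on_iff_eq_0[OF lin R], intro ballI impI)
    fix v assume v: "v \<in> ?R" "A v = 0"
    then obtain w where w: "w \<in> W" "v = A w" by blast
    then have "v \<bullet> v = w \<bullet> A v" using sym[of w v] v AW by auto
    then show "v = 0" using v by simp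
  qed
  then obtain g where g: "range g \<subseteq> ?R" "linear g" "\<And>v. v \<in> ?R \<Longrightarrow> g (A v) = v"
    using linear_exists_left_inverse_on[OF lin R] by blast
  have AgP: "A (g (P y)) = P y" for y
  proof -
    obtain w where "w \<in> W" "P y = A w" using P by blast
    then have "P y = A (P w)" using AP by simp
    then show ?thesis using g(3)[OF P(1)] by metis
  qed
  \<comment> \<open>With \<open>AgP\<close>, both products of \<open>A\<close> and the candidate
    equal the projection \<open>P\<close> on \<open>W\<close>; the four Penrose equations follow
    from this.\<close>
  have gA: "g (P (A x)) = P x" if "x \<in> W" for x
    using g(3)[OF P(1), of x] AP[OF that] Pid that by simp
  have "is_pinv W W A (\<lambda>y. g (P y))"
    unfolding is_pinv_def
  proof (intro conjI ballI)
    show "linear (\<lambda>y. g (P y))"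
      using linear_compose[OF linear_orth_proj[OF R] g(2)] by (simp add: P_def o_def)
    show "(\<lambda>y. g (P y)) ` W \<subseteq> W" using g(1) AW by blast
  qed (use P g AW AgP gA Pid AP Psym in auto)
  then show ?thesis by blast
qed

lemma is_pinv_pinv:
  assumes "subspace W" "linear A" "A ` W \<subseteq> W"
    and "\<And>x y. x \<in> W \<Longrightarrow> y \<in> W \<Longrightarrow> A x \<bullet> y = x \<bullet> A y"
  shows "is_pinv W W A (pinv W W A)"
  unfolding pinv_def using is_pinv_exists[OF assms] by (rule someI_ex)

section \<open>The largest eigenvalue and the Rayleigh quotient\<close>

text \<open>Eigenvectors for distinct eigenvalues are orthogonal, so choosing one per eigenvalue
  gives an independent set. Finiteness is what makes the \<open>Max\<close> in
  \<open>lambda_max\<close> meaningful.\<close>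

lemma finite_eigenvalues:
  assumes sym: "\<And>x y. x \<in> V \<Longrightarrow> y \<in> V \<Longrightarrow> A x \<bullet> y = x \<bullet> A (y :: real^'n)"
  shows "finite {l. \<exists>v\<in>V. v \<noteq> 0 \<and> A v = l *\<^sub>R v}" (is "finite ?E")
proof -
  obtain e where e: "\<And>l. l \<in> ?E \<Longrightarrow> e l \<in> V \<and> e l \<noteq> 0 \<and> A (e l) = l *\<^sub>R e l"
    using bchoice[of ?E "\<lambda>l v. v \<in> V \<and> v \<noteq> 0 \<and> A v = l *\<^sub>R v"] by blast
  have ortho: "e l \<bullet> e m = 0" if "l \<in> ?E" "m \<in> ?E" "l \<noteq> m" for l m
    using sym[of "e l" "e m"] e[OF that(1)] e[OF that(2)] that(3) by auto
  have "inj_on e ?E"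
  proof (rule inj_onI, rule ccontr)
    fix l m assume "l \<in> ?E" "m \<in> ?E" "e l = e m" "l \<noteq> m"
    then show False using ortho[of l m] e[of m] by simp
  qed
  moreover have "independent (e ` ?E)"
  proof (rule pairwise_orthogonal_independent)
    show "pairwise orthogonal (e ` ?E)"
      unfolding pairwise_def orthogonal_def
    proof (intro ballI impI)
      fix x y assume "x \<in> e ` ?E" "y \<in> e ` ?E" "x \<noteq> y"
      then obtain l m where lm: "l \<in> ?E" "m \<in> ?E" "x = e l" "y = e m" by (elim imageE)
      moreover have "l \<noteq> m" using lm(3,4) \<open>x \<noteq> y\<close> by blast
      ultimately show "x \<bullet> y = 0" using ortho by simp
    qed
    show "0 \<notin> e ` ?E"
    proof
      assume "0 \<in> e ` ?E"
      then obtain l where "l \<in> ?E" "e l = 0" by (elim imageE) simp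
      then show False using e by blast
    qed
  qed
  then have "finite (e ` ?E)" by (rule finiteI_independent)
  ultimately show ?thesis by (simp add: finite_image_iff)
qed

text \<open>Let \<open>v\<close> maximise the quadratic form on the compact unit sphere of
  \<open>V\<close>, with value \<open>m\<close>. Then \<open>m - A\<close> is positive semidefinite
  on \<open>V\<close> and has \<open>v\<close> as a null vector, so \<open>psd_on_null\<close>
  yields the eigenvector equation.\<close>

lemma rayleigh_max_eigenvector:
  assumes V: "subspace V" "V \<noteq> {0}" and A: "linear A" "A ` V \<subseteq> V"
    and sym: "\<And>x y. x \<in> V \<Longrightarrow> y \<in> V \<Longrightarrow> A x \<bullet> y = x \<bullet> A (y :: real^'n)"
  obtains v m where "v \<in> V" "v \<noteq> 0" "A v = m *\<^sub>R v" "\<forall>x\<in>V. x \<bullet> A x \<le> m * (x \<bullet> x)"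
proof -
  let ?S = "sphere 0 1 \<inter> V"
  obtain y where y: "y \<in> V" "y \<noteq> 0" using V subspace_0 by blast
  then have "y /\<^sub>R norm y \<in> ?S" using V by (simp add: subspace_scale)
  then have ne: "?S \<noteq> {}" by blast
  have "compact ?S" by (intro compact_Int_closed compact_sphere closed_subspace V)
  moreover have "continuous_on ?S (\<lambda>x. x \<bullet> A x)"
    using A(1) by (intro continuous_intros linear_continuous_on) (simp add: linear_conv_bounded_linear)
  ultimately obtain v where v: "v \<in> ?S" "\<And>x. x \<in> ?S \<Longrightarrow> x \<bullet> A x \<le> v \<bullet> A v"
    using continuous_attains_sup[OF _ ne] by blast
  define m where "m = v \<bullet> A v"
  have v1: "v \<in> V" "v \<noteq> 0" "v \<bullet> v = 1" using v by (auto simp: norm_eq_1)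
  have le: "x \<bullet> A x \<le> m * (x \<bullet> x)" if "x \<in> V" for x
  proof (cases "x = 0")
    case False
    have "x /\<^sub>R norm x \<in> ?S" using that V False by (simp add: subspace_scale)
    from v(2)[OF this] have "(x \<bullet> A x) / (norm x)\<^sup>2 \<le> m"
      by (simp add: linear_scale[OF A(1)] m_def power2_eq_square divide_inverse mult_ac)
    then show ?thesis using False by (simp add: divide_le_eq dot_square_norm)
  qed simp
  have "psd_on V (\<lambda>x. m *\<^sub>R x - A x)"
    unfolding psd_on_def
    using V A le sym
    by (auto simp: inner_diff_left inner_diff_right subspace_diff subspace_scale
        intro!: linear_compose_sub linear_compose_scale_right linear_id[unfolded id_def])
  then have "m *\<^sub>R v - A v = 0"
    by (rule psd_on_null[OF V(1) _ v1(1)]) (use v1 in \<open>simp add: inner_diff_right m_def\<close>)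
  then have "A v = m *\<^sub>R v" by simp
  then show ?thesis using that v1 le by simp
qed

text \<open>Trades the eigenvalue bound for an inequality of quadratic forms. The Rayleigh maximum
  is itself an eigenvalue, which gives one direction; testing the form on eigenvectors gives the
  other.\<close>

lemma lambda_max_le_iff:
  assumes V: "subspace V" "V \<noteq> {0}" and A: "linear A" "A ` V \<subseteq> V"
    and sym: "\<And>x y. x \<in> V \<Longrightarrow> y \<in> V \<Longrightarrow> A x \<bullet> y = x \<bullet> A (y :: real^'n)"
  shows "lambda_max V A \<le> c \<longleftrightarrow> (\<forall>x\<in>V. x \<bullet> A x \<le> c * (x \<bullet> x))"
proof -
  let ?E = "{l. \<exists>v\<in>V. v \<noteq> 0 \<and> A v = l *\<^sub>R v}"
  obtain v m where v: "v \<in> V" "v \<noteq> 0" "A v = m *\<^sub>R v"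
    and le: "\<forall>x\<in>V. x \<bullet> A x \<le> m * (x \<bullet> x)"
    by (rule rayleigh_max_eigenvector[OF assms])
  have "lambda_max V A \<le> c \<longleftrightarrow> (\<forall>l\<in>?E. l \<le> c)"
    unfolding lambda_max_def
  proof (rule Max_le_iff)
    show "finite ?E" by (rule finite_eigenvalues[OF sym])
    show "?E \<noteq> {}" using v by blast
  qed
  also have "\<dots> \<longleftrightarrow> (\<forall>x\<in>V. x \<bullet> A x \<le> c * (x \<bullet> x))"
  proof
    assume "\<forall>l\<in>?E. l \<le> c"
    then have "m \<le> c" using v by blast
    then show "\<forall>x\<in>V. x \<bullet> A x \<le> c * (x \<bullet> x)"
      by (intro ballI order_trans[OF bspec[OF le] mult_right_mono[OF _ inner_ge_zero]])
  next
    assume *: "\<forall>x\<in>V. x \<bullet> A x \<le> c * (x \<bullet> x)"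
    show "\<forall>l\<in>?E. l \<le> c"
    proof clarify
      fix l x assume x: "x \<in> V" "x \<noteq> 0" "A x = l *\<^sub>R x"
      have "l * (x \<bullet> x) \<le> c * (x \<bullet> x)" using bspec[OF * x(1)] unfolding x(3) by simp
      then show "l \<le> c" by (rule mult_right_le_imp_le) (simp add: x(2))
    qed
  qed
  finally show ?thesis .
qed

subsection \<open>The generalized Schur complement\<close>

text \<open>The generalized Schur complement of the \<open>W\<close> block, stated for an arbitrary
  matrix so that the linear algebra is separated from \<open>f\<close> and the point
  \<open>z\<close>.\<close>

definition schur :: "(real^'n) set \<Rightarrow> real^'n^'n \<Rightarrow> real^'n \<Rightarrow> real^'n" where
  "schur W H x = (let V = orthogonal_comp W in
     block V V H x + block V W H (pinv W W (\<lambda>w. - block W W H w) (block W V H x)))"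

lemma R_op_eq_schur: "R_op f W z = schur W (hessian f z)"
  by (auto simp: fun_eq_iff R_op_def schur_def Let_def)

locale block_decomp =
  fixes W V :: "(real^'n) set" and H :: "real^'n^'n"
  assumes W: "subspace W" and V_def: "V = orthogonal_comp W"
    and sym: "(H *v x) \<bullet> y = x \<bullet> (H *v y)"
begin

abbreviation A where "A \<equiv> (\<lambda>w. - block W W H w)"
abbreviation "Q \<equiv> block W V H"

lemma V: "subspace V" by (simp add: V_def subspace_orthogonal_comp)

lemma ortho: "x \<in> V \<Longrightarrow> w \<in> W \<Longrightarrow> x \<bullet> w = 0" "x \<in> V \<Longrightarrow> w \<in> W \<Longrightarrow> w \<bullet> x = 0"
  by (auto simp: V_def inner_orthogonal_comp)

lemma linear_A: "linear A"
  using linear_compose_neg[OF linear_block[OF W W]] by simp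

lemma A_in: "A x \<in> W"
  by (simp add: W block_in subspace_neg)

lemma A_sym: "A x \<bullet> y = x \<bullet> A y"
  using inner_block_swap[OF W W sym] by simp

lemma is_pinv_A: "is_pinv W W A (pinv W W A)"
  by (rule is_pinv_pinv) (use W linear_A A_in A_sym in auto)

lemma schur_eq: "schur W H x = block V V H x + block V W H (pinv W W A (Q x))"
  by (simp add: schur_def Let_def V_def)

lemma linear_schur: "linear (schur W H)"
proof -
  have "linear (block V W H \<circ> pinv W W A \<circ> Q)"
    using is_pinv_A by (intro linear_compose linear_block V W) (simp add: is_pinv_def)
  then show ?thesis
    using linear_compose_add[OF linear_block[OF V V]] unfolding o_def schur_eq[abs_def] by blast
qed

lemma schur_in: "schur W H x \<in> V"
  by (simp add: schur_eq V block_in subspace_add)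

text \<open>Once \<open>Q x\<close> and \<open>Q y\<close> have preimages under \<open>A\<close>,
  the identity \<open>A G A = A\<close> eliminates the pseudoinverse \<open>G\<close>, and any
  choice of preimages gives the same value.\<close>

lemma inner_schur:
  assumes "x \<in> V" "y \<in> V" "u \<in> W" "v \<in> W" "A u = Q x" "A v = Q y"
  shows "schur W H x \<bullet> y = (H *v x) \<bullet> y + u \<bullet> A v"
proof -
  let ?G = "pinv W W A"
  have "block V W H (?G (Q x)) \<bullet> y = ?G (A u) \<bullet> A v"
    using inner_block_swap[OF V W sym, of "?G (Q x)" y] assms by simp
  also have "\<dots> = A (?G (A u)) \<bullet> v" by (simp only: A_sym)
  also have "\<dots> = A u \<bullet> v" using is_pinv_A assms unfolding is_pinv_def by metis
  also have "\<dots> = u \<bullet> A v" by (rule A_sym)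
  finally show ?thesis
    using inner_block[OF V V] assms by (simp only: schur_eq inner_add_left)
qed

text \<open>Completing the square in \<open>w\<close>: the cross terms give
  \<open>2 * (w \<bullet> A u)\<close>, and the missing \<open>u \<bullet> A u\<close> is precisely
  what \<open>schur\<close> adds to the \<open>V\<close> block.\<close>

lemma quadratic_form:
  assumes "x \<in> V" "w \<in> W" "u \<in> W" "A u = Q x"
  shows "(x + w) \<bullet> (H *v (x + w)) = x \<bullet> schur W H x - (w - u) \<bullet> A (w - u)"
proof -
  have 1: "w \<bullet> (H *v x) = w \<bullet> A u"
    using inner_block[OF W V] assms by (simp add: inner_commute)
  have 2: "w \<bullet> (H *v w) = - (w \<bullet> A w)"
    using inner_block[OF W W] assms by (simp add: inner_commute)
  have 3: "x \<bullet> schur W H x = x \<bullet> (H *v x) + u \<bullet> A u"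
    using inner_schur[OF assms(1,1,3,3,4,4)] by (simp only: inner_commute)
  have 4: "x \<bullet> (H *v w) = w \<bullet> (H *v x)" using sym[of w x] by (simp add: inner_commute)
  have 5: "u \<bullet> A w = w \<bullet> A u" using A_sym[of u w] by (simp add: inner_commute)
  show ?thesis
    unfolding linear_diff[OF linear_A] 3
    by (simp only: matrix_vector_right_distrib inner_add_left inner_add_right inner_diff_left
        inner_diff_right 1 2 4 5)
qed

lemma schur_sym:
  assumes "Q ` V \<subseteq> A ` W" "x \<in> V" "y \<in> V"
  shows "schur W H x \<bullet> y = x \<bullet> schur W H y"
proof -
  obtain u v where uv: "u \<in> W" "v \<in> W" "A u = Q x" "A v = Q y"
    using assms by (metis (no_types, lifting) imageE image_subset_iff)
  show ?thesis
    using inner_schur[OF assms(2,3) uv] inner_schur[OF assms(3,2) uv(2,1,4,3)]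
      sym[of x y] A_sym[of u v] by (simp only: inner_commute)
qed

lemma decomp: "orth_proj V x \<in> V" "orth_proj W x \<in> W" "x = orth_proj V x + orth_proj W x"
  by (auto simp: orth_proj_in V W) (simp add: V_def orth_proj_orthogonal_comp W)

text \<open>The matrix of \<open>B (orth_proj V x)\<close> is diag(B, 0), because the projection
  annihilates \<open>W\<close>. The form of its difference with \<open>H\<close> splits into one
  term on \<open>V\<close> and one square in \<open>A\<close>.\<close>

lemma psd_block_diag_iff:
  assumes BV: "psd_on V B"
  shows "psd_on UNIV ((*v) (matrix (\<lambda>x. B (orth_proj V x)) - H)) \<longleftrightarrow>
    psd_on W A \<and> Q ` V \<subseteq> A ` W \<and> loewner_le_on V (schur W H) B"
    (is "psd_on UNIV ((*v) (?M - H)) \<longleftrightarrow> ?R")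
proof -
  have B: "linear B" "\<And>x. x \<in> V \<Longrightarrow> B x \<in> V"
    "\<And>x y. x \<in> V \<Longrightarrow> y \<in> V \<Longrightarrow> B x \<bullet> y = x \<bullet> B y"
    using BV by (auto simp: psd_on_def)
  have "linear (\<lambda>x. B (orth_proj V x))"
    using linear_compose[OF linear_orth_proj[OF V] B(1)] by (simp add: o_def)
  then have M: "(?M - H) *v x = B (orth_proj V x) - H *v x" for x
    by (simp add: matrix_vector_mult_diff_rdistrib matrix_works)
  have projW: "w \<in> W \<Longrightarrow> orth_proj V w = 0" for w
    by (simp add: V_def orth_proj_orthogonal_comp W)
  have B0: "B 0 = 0" using B(1) by (rule linear_0)
  have form: "(x + w) \<bullet> ((?M - H) *v (x + w)) = x \<bullet> (B x - schur W H x) + (w - u) \<bullet> A (w - u)"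
    if "x \<in> V" "w \<in> W" "u \<in> W" "A u = Q x" for x w u
  proof -
    have "orth_proj V (x + w) = x"
      using that by (simp add: linear_add[OF linear_orth_proj[OF V]] projW V)
    then show ?thesis
      unfolding M inner_diff_right quadratic_form[OF that]
      using ortho that B(2)[OF that(1)] by (simp add: inner_add_left)
  qed
  show ?thesis
  proof
    assume psd: "psd_on UNIV ((*v) (?M - H))"
    then have pos: "0 \<le> x \<bullet> ((?M - H) *v x)" for x by (auto simp: psd_on_def)
    have wform: "w \<bullet> ((?M - H) *v w) = w \<bullet> A w" if "w \<in> W" for w
      using that inner_block[OF W W that that] by (simp add: M projW B0 inner_commute)
    have 1: "psd_on W A"
      unfolding psd_on_def
    proof (intro conjI ballI)
      fix w assume "w \<in> W"
      show "0 \<le> w \<bullet> A w" using pos[of w] unfolding wform[OF \<open>w \<in> W\<close>] .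
    qed (use linear_A A_in A_sym in auto)
    \<comment> \<open>It suffices that \<open>Q x\<close> is orthogonal to the kernel of
      \<open>A\<close> in \<open>W\<close>; such kernel vectors are null vectors of the whole form
      and therefore killed by \<open>H\<close>.\<close>
    have 2: "Q ` V \<subseteq> A ` W"
    proof (rule image_subsetI, rule selfadjoint_range_if_orthogonal_kernel[OF W linear_A])
      fix x k assume x: "x \<in> V" and k: "k \<in> W" "A k = 0"
      have "(?M - H) *v k = 0"
        by (rule psd_on_null[OF subspace_UNIV psd]) (use wform k in auto)
      then have "H *v k = 0" using k(1) by (simp add: M projW B0)
      then show "Q x \<bullet> k = 0" using inner_block[OF W V x k(1)] sym[of x k] by simp
    qed (use A_in A_sym block_in W in auto)
    have "0 \<le> x \<bullet> (B x - schur W H x)" if x: "x \<in> V" for x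
    proof -
      \<comment> \<open>At \<open>w = u\<close> the square in \<open>A\<close> vanishes, so
        positivity at \<open>x + u\<close> isolates the Schur term.\<close>
      obtain u where "u \<in> W" "A u = Q x" using 2 x by (metis (no_types, lifting) imageE image_subset_iff)
      then show ?thesis using form[OF x _ _ \<open>A u = Q x\<close>, of u] pos[of "x + u"] linear_0[OF linear_A]
        by simp
    qed
    then have "loewner_le_on V (schur W H) B"
      unfolding loewner_le_on_def psd_on_def
      using B schur_in schur_sym[OF 2] linear_compose_sub[OF B(1) linear_schur] V
      by (auto simp: subspace_diff inner_diff_left inner_diff_right)
    then show ?R using 1 2 by blast
  next
    assume R: ?R
    \<comment> \<open>\<open>B\<close> is known to be symmetric on \<open>V\<close> only; the
      projection extends this to the whole space.\<close>
    have "(B (orth_proj V x)) \<bullet> y = x \<bullet> B (orth_proj V y)" for x y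
      using B(3)[OF decomp(1,1), of x y] inner_orth_proj[OF V B(2)[OF decomp(1)]] by simp
    then have s: "((?M - H) *v x) \<bullet> y = x \<bullet> ((?M - H) *v y)" for x y
      by (simp add: M inner_diff_left inner_diff_right sym)
    have "0 \<le> x \<bullet> ((?M - H) *v x)" for x
    proof -
      let ?v = "orth_proj V x" and ?w = "orth_proj W x"
      obtain u where u: "u \<in> W" "A u = Q ?v"
        using R decomp(1)[of x] by (metis (no_types, lifting) imageE image_subset_iff)
      have "?w - u \<in> W" using u decomp W by (simp add: subspace_diff)
      then have "0 \<le> (?w - u) \<bullet> A (?w - u)"
        using R by (simp only: psd_on_def)
      moreover have "0 \<le> ?v \<bullet> (B ?v - schur W H ?v)"
        using R decomp(1)[of x] by (simp only: loewner_le_on_def psd_on_def)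
      ultimately show ?thesis
        using form[OF decomp(1) decomp(2)[of x] u] unfolding decomp(3)[of x, symmetric] by simp
    qed
    then show "psd_on UNIV ((*v) (?M - H))" using s by (simp add: psd_on_def)
  qed
qed

lemma lambda_max_schur_le_iff:
  assumes "Q ` V \<subseteq> A ` W" "V \<noteq> {0}"
  shows "lambda_max V (schur W H) \<le> c \<longleftrightarrow> (\<forall>x\<in>V. x \<bullet> schur W H x \<le> c * (x \<bullet> x))"
  by (rule lambda_max_le_iff) (use assms V linear_schur schur_in schur_sym in auto)

text \<open>Shares its right-hand side with \<open>lambda_max_schur_le_iff\<close>, and so links the
  Loewner bound to the eigenvalue bound. It also covers \<open>V = {0}\<close>, where
  \<open>lambda_max\<close> is a junk value.\<close>

lemma schur_le_scaleR_iff: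
  assumes "Q ` V \<subseteq> A ` W"
  shows "loewner_le_on V (schur W H) (\<lambda>x. c *\<^sub>R x) \<longleftrightarrow> (\<forall>x\<in>V. x \<bullet> schur W H x \<le> c * (x \<bullet> x))"
  unfolding loewner_le_on_def psd_on_def
  using V linear_schur schur_in schur_sym[OF assms]
  by (auto simp: inner_diff_left inner_diff_right subspace_diff subspace_scale
      intro!: linear_compose_sub linear_compose_scale_right linear_id[unfolded id_def])

lemma loewner_le_zero_iff: "loewner_le_on W (block W W H) (\<lambda>_. 0) \<longleftrightarrow> psd_on W A"
  by (simp add: loewner_le_on_def)

end

subsection \<open>Curvature bounds\<close>

lemma psd_block_diag:
  assumes V: "subspace V" and B: "psd_on V B"
  shows "psd_on UNIV ((*v) (matrix (\<lambda>x. B (orth_proj V x))))"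
proof -
  let ?P = "orth_proj V"
  have B': "linear B" "\<And>x. x \<in> V \<Longrightarrow> B x \<in> V" using B by (auto simp: psd_on_def)
  have "linear (\<lambda>x. B (?P x))"
    using linear_compose[OF linear_orth_proj[OF V] B'(1)] by (simp add: o_def)
  then have M: "matrix (\<lambda>x. B (?P x)) *v x = B (?P x)" for x by (simp add: matrix_works)
  have P: "?P x \<in> V" for x by (rule orth_proj_in[OF V])
  have "B (?P x) \<bullet> y = x \<bullet> B (?P y)" for x y
    using B P[of x] P[of y] inner_orth_proj[OF V B'(2)[OF P]] unfolding psd_on_def by metis
  moreover have "0 \<le> x \<bullet> B (?P x)" for x
    using B P[of x] inner_orth_proj(1)[OF V B'(2)[OF P]] unfolding psd_on_def by metis
  ultimately show ?thesis by (simp add: psd_on_def M)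
qed

lemma psd_on_scaleR:
  assumes "subspace V" "0 \<le> c"
  shows "psd_on V (\<lambda>x. c *\<^sub>R x)"
  using assms by (auto simp: psd_on_def subspace_scale
      intro!: linear_compose_scale_right linear_id[unfolded id_def])

text \<open>By symmetry, a matrix that kills \<open>W\<close> has its range in \<open>V\<close>, so
  it is block diagonal with zero \<open>W\<close> block. This lets an arbitrary witness of
  feasibility enter the criterion for block matrices.\<close>

lemma psd_matrix_vanishing_on:
  assumes W: "subspace W" and V: "V = orthogonal_comp W"
    and B: "psd_on UNIV ((*v) B)" and ker: "\<And>w. w \<in> W \<Longrightarrow> B *v w = 0"
  shows "psd_on V ((*v) B)" and "matrix (\<lambda>x. B *v orth_proj V x) = B"
proof -
  have sym: "(B *v x) \<bullet> y = x \<bullet> (B *v y)" for x y using B by (simp add: psd_on_def)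
  have "B *v x \<in> V" for x
    using sym[of x] ker by (auto simp: V orthogonal_comp_def orthogonal_def inner_commute)
  then show "psd_on V ((*v) B)" using B by (auto simp: psd_on_def)
  have "B *v orth_proj V x = B *v x" for x
    using ker[OF orth_proj_in[OF W]]
    by (simp add: V orth_proj_orthogonal_comp W matrix_vector_mult_diff_distrib)
  then show "matrix (\<lambda>x. B *v orth_proj V x) = B" by simp
qed

text \<open>The supremum is taken in \<open>ereal\<close>, so that (iii) can be expressed as
  \<open>s < \<infinity>\<close>. For \<open>V = {0}\<close> it would be formed from junk values,
  which is why that case is guarded and the lower bound for \<alpha> becomes 0.\<close>

theorem theorem4p1:
  fixes X U V W :: "(real^'n) set" and f :: "real^'n \<Rightarrow> real"
  assumes "compact X" and "affine hull X = UNIV"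
    and "open U" and "convex hull X \<subseteq> U" and "C2_on U f"
    and "subspace W" and "V = orthogonal_comp W"
  shows
    "let cond_i_ii = (\<forall>z\<in>convex hull X.
           loewner_le_on W (block W W (hessian f z)) (\<lambda>_. 0) \<and>
           block W V (hessian f z) ` V \<subseteq> (\<lambda>w. - block W W (hessian f z) w) ` W);
         s = (SUP z\<in>convex hull X. ereal (lambda_max V (R_op f W z)));
         cond_iii = (V \<noteq> {0} \<longrightarrow> s < \<infinity>)
     in
       (feasible_curvature_free f X W \<longleftrightarrow> cond_i_ii \<and> cond_iii) \<and>
       (cond_i_ii \<and> cond_iii \<longrightarrow>
          (\<forall>\<alpha>::real. ereal \<alpha> \<ge> (if V = {0} then 0 else max 0 s) \<longrightarrow>
             \<alpha> *\<^sub>R matrix (orth_proj V) \<in> curvature_bounds f X)) \<and>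
       (\<forall>B\<^sub>V. psd_on V B\<^sub>V \<longrightarrow>
          (matrix (\<lambda>x. B\<^sub>V (orth_proj V x)) \<in> curvature_bounds f X \<longleftrightarrow>
             cond_i_ii \<and> (\<forall>z\<in>convex hull X. loewner_le_on V (R_op f W z) B\<^sub>V)))"
proof -
  let ?C = "convex hull X"
  define cond where "cond \<longleftrightarrow> (\<forall>z\<in>?C. loewner_le_on W (block W W (hessian f z)) (\<lambda>_. 0) \<and>
    block W V (hessian f z) ` V \<subseteq> (\<lambda>w. - block W W (hessian f z) w) ` W)"
  define s where "s = (SUP z\<in>?C. ereal (lambda_max V (R_op f W z)))"
  have bd: "block_decomp W V (hessian f z)" if "z \<in> ?C" for z
    using that assms hessian_selfadjoint[of U z f] by unfold_locales auto
  have V: "subspace V" using assms(7) by (simp add: subspace_orthogonal_comp)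
  have range: "block W V (hessian f z) ` V \<subseteq> (\<lambda>w. - block W W (hessian f z) w) ` W"
    if "cond" "z \<in> ?C" for z using that by (simp add: cond_def)

  \<comment> \<open>The criterion for block matrices comes first: the other two claims apply it to
    \<open>B = \<alpha> I\<close> and to a given feasible matrix.\<close>
  have block_diag: "matrix (\<lambda>x. B (orth_proj V x)) \<in> curvature_bounds f X \<longleftrightarrow>
      cond \<and> (\<forall>z\<in>?C. loewner_le_on V (R_op f W z) B)" if B: "psd_on V B" for B
  proof -
    have "matrix (\<lambda>x. B (orth_proj V x)) \<in> curvature_bounds f X \<longleftrightarrow>
        (\<forall>z\<in>?C. psd_on UNIV ((*v) (matrix (\<lambda>x. B (orth_proj V x)) - hessian f z)))"
      by (simp add: curvature_bounds_def psd_block_diag[OF V B])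
    then show ?thesis
      unfolding cond_def R_op_eq_schur
      using block_decomp.psd_block_diag_iff[OF bd B] block_decomp.loewner_le_zero_iff[OF bd]
      by (simp only: ball_conj_distrib cong: ball_cong) blast
  qed

  have scaled: "\<alpha> *\<^sub>R matrix (orth_proj V) \<in> curvature_bounds f X"
    if "cond" and \<alpha>: "ereal \<alpha> \<ge> (if V = {0} then 0 else max 0 s)" for \<alpha>
  proof -
    have "0 \<le> \<alpha>" using \<alpha> by (auto split: if_splits)
    have "loewner_le_on V (R_op f W z) (\<lambda>x. \<alpha> *\<^sub>R x)" if z: "z \<in> ?C" for z
    proof -
      interpret block_decomp W V "hessian f z" by (rule bd[OF z])
      note rng = range[OF \<open>cond\<close> z]
      show ?thesis
      proof (cases "V = {0}")
        case True
        then show ?thesis using schur_le_scaleR_iff[OF rng] by (simp add: R_op_eq_schur)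
      next
        case False
        have "ereal (lambda_max V (R_op f W z)) \<le> s" unfolding s_def by (rule SUP_upper[OF z])
        also have "s \<le> ereal \<alpha>" using \<alpha> False by simp
        finally show ?thesis
          using lambda_max_schur_le_iff[OF rng False] schur_le_scaleR_iff[OF rng]
          by (simp add: R_op_eq_schur)
      qed
    qed
    then have "matrix (\<lambda>x. \<alpha> *\<^sub>R orth_proj V x) \<in> curvature_bounds f X"
      using block_diag[OF psd_on_scaleR[OF V \<open>0 \<le> \<alpha>\<close>]] \<open>cond\<close> by blast
    moreover have "matrix (\<lambda>x. \<alpha> *\<^sub>R orth_proj V x) = \<alpha> *\<^sub>R matrix (orth_proj V)"
      by (simp add: matrix_def vec_eq_iff)
    ultimately show ?thesis by simp
  qed

  have "feasible_curvature_free f X W \<longleftrightarrow> cond \<and> (V \<noteq> {0} \<longrightarrow> s < \<infinity>)"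
  proof
    assume "feasible_curvature_free f X W"
    then obtain B where B: "B \<in> curvature_bounds f X" "\<And>w. w \<in> W \<Longrightarrow> B *v w = 0"
      unfolding feasible_curvature_free_def by blast
    then have psd: "psd_on UNIV ((*v) B)" by (simp add: curvature_bounds_def)
    note BV = psd_matrix_vanishing_on[OF assms(6,7) psd B(2)]
    have c: "cond" and le: "\<And>z. z \<in> ?C \<Longrightarrow> loewner_le_on V (R_op f W z) ((*v) B)"
      using block_diag[OF BV(1)] B(1) BV(2) by auto
    \<comment> \<open>The operator norm of the one matrix \<open>B\<close> bounds every Rayleigh
      quotient of \<open>R_op f W z\<close>, uniformly in \<open>z\<close>.\<close>
    have "s \<le> ereal (onorm ((*v) B))" if "V \<noteq> {0}"
      unfolding s_def
    proof (rule SUP_least)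
      fix z assume z: "z \<in> ?C"
      have "x \<bullet> R_op f W z x \<le> onorm ((*v) B) * (x \<bullet> x)" if "x \<in> V" for x
      proof -
        have "x \<bullet> R_op f W z x \<le> x \<bullet> (B *v x)"
          using le[OF z] that by (simp add: loewner_le_on_def psd_on_def inner_diff_right)
        also have "\<dots> \<le> norm x * norm (B *v x)" by (rule norm_cauchy_schwarz)
        also have "\<dots> \<le> norm x * (onorm ((*v) B) * norm x)"
          by (intro mult_left_mono onorm) (auto simp: matrix_vector_mul_bounded_linear)
        finally show ?thesis by (simp add: dot_square_norm power2_eq_square mult_ac)
      qed
      then show "ereal (lambda_max V (R_op f W z)) \<le> ereal (onorm ((*v) B))"
        using block_decomp.lambda_max_schur_le_iff[OF bd[OF z] range[OF c z] that]
        by (simp add: R_op_eq_schur)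
    qed
    then show "cond \<and> (V \<noteq> {0} \<longrightarrow> s < \<infinity>)"
      using c le_less_trans[of s _ \<infinity>] less_ereal.simps(4) by blast
  next
    assume *: "cond \<and> (V \<noteq> {0} \<longrightarrow> s < \<infinity>)"
    \<comment> \<open>Taking the maximum with 0 excludes the value minus infinity, and (iii)
      excludes plus infinity, so the bound is a real number.\<close>
    have "\<exists>\<alpha>::real. ereal \<alpha> \<ge> (if V = {0} then 0 else max 0 s)"
    proof (cases "V = {0}")
      case False
      then have "max 0 s \<noteq> \<infinity>" "max 0 s \<noteq> -\<infinity>" using * by (auto simp: max_def)
      then obtain \<alpha> where "max 0 s = ereal \<alpha>" by (cases "max 0 s") auto
      then show ?thesis using False by (intro exI[of _ \<alpha>]) simp
    qed (auto intro: exI[of _ 0])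
    then obtain \<alpha> where "\<alpha> *\<^sub>R matrix (orth_proj V) \<in> curvature_bounds f X"
      using scaled * by blast
    moreover have "(\<alpha> *\<^sub>R matrix (orth_proj V)) *v w = 0" if "w \<in> W" for w
    proof -
      have "matrix (orth_proj V) *v w = orth_proj V w"
        by (simp add: matrix_works linear_orth_proj[OF V])
      also have "\<dots> = 0" using that assms(6,7) by (simp add: orth_proj_orthogonal_comp)
      finally show ?thesis by (simp add: scaleR_matrix_vector_assoc[symmetric])
    qed
    ultimately show "feasible_curvature_free f X W"
      using assms(6) unfolding feasible_curvature_free_def by blast
  qed
  then show ?thesis
    using scaled block_diag
    unfolding Let_def cond_def[symmetric] s_def[symmetric] by blast
qed

end
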